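(* Let $k\ge 0$ be an integer and let $f:\mathbb{R}\to\mathbb{R}$ be a function that is $k$-times differentiable over an interval $[a,b]$. Let $x_0\in(a,b)$. If $f^{(k)}$ is monotonically increasing over $[a,b]$, then the interval defining the degree $k$ sharp Taylor polynomial enclosure of $f$ at $x_0$ over $[a,b]$ is $$I^*_k(f,x_0,[a,b])=\left[\frac{R_{k-1}(a;f,x_0)}{(a-x_0)^k},\ \frac{R_{k-1}(b;f,x_0)}{(b-x_0)^k}\right].$$ If $f^{(k)}$ is monotonically decreasing over $[a,b]$, then instead $$I^*_k(f,x_0,[a,b])=\left[\frac{R_{k-1}(b;f,x_0)}{(b-x_0)^k},\ \frac{R_{k-1}(a;f,x_0)}{(a-x_0)^k}\right].$$
   Context: For an integer $j\ge 0$, $T_j(x;f,x_0)=\sum_{i=0}^{j}\frac{1}{i!}f^{(i)}(x_0)(x-x_0)^i$ is the degree $j$ Taylor polynomial of $f$ at $x_0$ and $R_j(x;f,x_0)=f(x)-T_j(x;f,x_0)$ is the remainder; by convention $T_{-1}(x;f,x_0)=0$ and $R_{-1}(x;f,x_0)=f(x)$. The interval defining the degree $k$ sharp Taylor polynomial enclosure of $f$ at $x_0$ over the trust region $[a,b]$ is $$I^*_k(f,x_0,[a,b])=\left[\inf_{x\in[a,b]\setminus\{x_0\}}\frac{R_{k-1}(x;f,x_0)}{(x-x_0)^k},\ \sup_{x\in[a,b]\setminus\{x_0\}}\frac{R_{k-1}(x;f,x_0)}{(x-x_0)^k}\right].$$ "Monotonically increasing" (resp. "decreasing") is meant in the weak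 sense: nondecreasing (resp. nonincreasing). *)

theory Defs
  imports "HOL-Analysis.Analysis"
begin

(* The i-th derivative of f relative to S: at boundary points of an interval
   S = {a..b} the derivatives are one-sided, at interior points they are the usual
   ones (see nth_deriv_on_interior below).  Values outside S are irrelevant. *)
primrec nth_deriv_on :: "real set \<Rightarrow> nat \<Rightarrow> (real \<Rightarrow> real) \<Rightarrow> real \<Rightarrow> real" where
  "nth_deriv_on S 0 f = f"
| "nth_deriv_on S (Suc i) f = (\<lambda>x. vector_derivative (nth_deriv_on S i f) (at x within S))"

definition times_differentiable_on :: "nat \<Rightarrow> (real \<Rightarrow> real) \<Rightarrow> real set \<Rightarrow> bool" where
  "times_differentiable_on k f S \<longleftrightarrow> (\<forall>i<k. nth_deriv_on S i f differentiable_on S)"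

(* S is only the domain relative to which derivatives are taken; when x0 is interior to S
   the polynomial does not depend on it.  The index j is an integer so that j = -1 is
   meaningful: the sum is then empty and the polynomial is 0. *)
definition taylor_poly :: "real set \<Rightarrow> int \<Rightarrow> (real \<Rightarrow> real) \<Rightarrow> real \<Rightarrow> real \<Rightarrow> real" where
  "taylor_poly S j f x0 x =
     (\<Sum>i | int i \<le> j. 1 / fact i * nth_deriv_on S i f x0 * (x - x0) ^ i)"

definition taylor_remainder :: "real set \<Rightarrow> int \<Rightarrow> (real \<Rightarrow> real) \<Rightarrow> real \<Rightarrow> real \<Rightarrow> real" where
  "taylor_remainder S j f x0 x = f x - taylor_poly S j f x0 x"

(* The infimum and supremum are taken in the extended reals, since on type real they are
   unspecified for unbounded sets; the result is the set of reals lying between them. *)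
definition sharp_taylor_interval :: "nat \<Rightarrow> (real \<Rightarrow> real) \<Rightarrow> real \<Rightarrow> real set \<Rightarrow> real set" where
  "sharp_taylor_interval k f x0 S =
     {y. (INF x\<in>S - {x0}. ereal (taylor_remainder S (int k - 1) f x0 x / (x - x0) ^ k)) \<le> ereal y
       \<and> ereal y \<le> (SUP x\<in>S - {x0}. ereal (taylor_remainder S (int k - 1) f x0 x / (x - x0) ^ k))}"

lemma nth_deriv_on_interior:
  assumes "x \<in> interior S"
  shows "nth_deriv_on S i f x = (deriv ^^ i) f x"
  using assms
proof (induction i arbitrary: x)
  case (Suc i)
  have ev: "eventually (\<lambda>y. nth_deriv_on S i f y = (deriv ^^ i) f y) (nhds x)"
    using Suc by (intro eventually_nhds_in_open[THEN eventually_mono, of "interior S"]) auto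
  have "vector_derivative (nth_deriv_on S i f) (at x within S) = deriv (nth_deriv_on S i f) x"
    by (simp add: at_within_interior[OF Suc.prems] vector_derivative_def deriv_def
        has_real_derivative_iff_has_vector_derivative)
  also have "\<dots> = deriv ((deriv ^^ i) f) x"
    by (rule deriv_cong_ev[OF ev refl])
  finally show ?case by simp
qed simp

lemma taylor_poly_neg1: "taylor_poly S (-1) f x0 x = 0"
  by (simp add: taylor_poly_def)

lemma taylor_poly_nat:
  "taylor_poly S (int j) f x0 x = (\<Sum>i\<le>j. 1 / fact i * nth_deriv_on S i f x0 * (x - x0) ^ i)"
  by (simp add: taylor_poly_def atMost_def)

end

theory Submission
  imports Defs
begin

text \<open>
  Write \<open>q\<^sub>k(x) = R\<^sub>k\<^sub>-\<^sub>1(x; f, x\<^sub>0) / (x - x\<^sub>0)\<^sup>k\<close>. If \<open>f\<^sup>(\<^sup>k\<^sup>)\<close> is monotone on \<open>[a, b]\<close>, then \<open>q\<^sub>k\<close> is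
  monotone in the same direction on the whole punctured interval \<open>[a, b] - {x\<^sub>0}\<close>, across \<open>x\<^sub>0\<close>
  as well. Its infimum and supremum are therefore attained at the endpoints, which is the theorem.

  Monotonicity of \<open>q\<^sub>k\<close> follows by induction on \<open>k\<close>, for all \<open>f\<close> at once. For \<open>k = 0\<close> the quotient
  is \<open>f\<close> itself. For the step, differentiating a Taylor remainder of \<open>f\<close> yields the remainder of
  one lower degree of \<open>f'\<close> (\<open>taylor_remainder_Suc_derivative\<close>), so the ratio of the derivatives of
  numerator and denominator of \<open>q\<^sub>k\<^sub>+\<^sub>1\<close> is, up to the factor \<open>1 / (k + 1)\<close>, the quotient \<open>q\<^sub>k\<close>
  of \<open>f'\<close>. This is monotone by the induction hypothesis, and the monotone form of l'Hopital's
  rule (\<open>mono_on_quotient_power\<close>) carries monotonicity from the ratio of the derivatives to the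
  ratio of the functions.
\<close>

text \<open>
  Cauchy's mean value theorem for \<open>F\<close> against \<open>(y - x\<^sub>0)\<^sup>n\<^sup>+\<^sup>1\<close>. Segments in place of intervals let
  \<open>x\<close> lie on either side of \<open>x\<^sub>0\<close>.
\<close>
lemma cauchy_mean_value_power:
  fixes F F' :: "real \<Rightarrow> real" and x0 x :: real
  assumes "continuous_on (closed_segment x0 x) F" and "x \<noteq> x0" and "F x0 = 0"
    and deriv: "\<And>y. y \<in> open_segment x0 x \<Longrightarrow> (F has_real_derivative F' y) (at y)"
  obtains \<xi> where "\<xi> \<in> open_segment x0 x"
    and "real (Suc n) * (F x / (x - x0) ^ Suc n) = F' \<xi> / (\<xi> - x0) ^ n"
proof -
  let ?G = "\<lambda>y. (y - x0) ^ Suc n" and ?G' = "\<lambda>y. real (Suc n) * (y - x0) ^ n"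
  \<comment> \<open>Vanishes at both \<open>x\<^sub>0\<close> and \<open>x\<close>, so Rolle's theorem applies.\<close>
  let ?\<phi> = "\<lambda>y. F y * ?G x - F x * ?G y"
  have seg: "closed_segment x0 x = {min x0 x..max x0 x}" "open_segment x0 x = {min x0 x<..<max x0 x}"
    by (auto simp: closed_segment_eq_real_ivl open_segment_eq_real_ivl)
  have \<phi>: "(?\<phi> has_real_derivative F' y * ?G x - F x * ?G' y) (at y)" if "y \<in> open_segment x0 x" for y
    by (rule derivative_eq_intros deriv that refl | simp)+
  have "\<exists>\<xi>. min x0 x < \<xi> \<and> \<xi> < max x0 x \<and> (*) (F' \<xi> * ?G x - F x * ?G' \<xi>) = (\<lambda>v. 0)"
  proof (rule Rolle_deriv)
    show "min x0 x < max x0 x" using \<open>x \<noteq> x0\<close> by auto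
    show "?\<phi> (min x0 x) = ?\<phi> (max x0 x)" using \<open>F x0 = 0\<close> by (simp add: min_def max_def)
    show "continuous_on {min x0 x..max x0 x} ?\<phi>"
      using assms(1) unfolding seg by (intro continuous_intros)
    show "(?\<phi> has_derivative (*) (F' y * ?G x - F x * ?G' y)) (at y)"
      if "min x0 x < y" "y < max x0 x" for y
      using \<phi>[of y] that unfolding seg has_field_derivative_def by simp
  qed
  then obtain \<xi> where \<xi>: "\<xi> \<in> open_segment x0 x" "F x * ?G' \<xi> = ?G x * F' \<xi>"
    unfolding seg by (auto simp: fun_eq_iff mult.commute dest: spec[of _ 1])
  have "\<xi> \<noteq> x0" using \<xi>(1) by (auto simp: open_segment_def)
  then have "real (Suc n) * (F x / ?G x) = F' \<xi> / (\<xi> - x0) ^ n"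
    using \<xi>(2) \<open>x \<noteq> x0\<close> by (simp add: frac_eq_eq mult_ac del: of_nat_Suc power_Suc)
  then show thesis using that \<xi>(1) by blast
qed

text \<open>
  Let \<open>h = F / (x - x\<^sub>0)\<^sup>n\<^sup>+\<^sup>1\<close> and let \<open>r = F' / (x - x\<^sub>0)\<^sup>n\<close>, which is \<open>n + 1\<close> times the ratio of
  the derivatives. Differentiating gives \<open>h' = (r - (n + 1) h) / (x - x\<^sub>0)\<close>, and
  \<open>(n + 1) h x = r \<xi>\<close> for some \<open>\<xi>\<close> between \<open>x\<^sub>0\<close> and \<open>x\<close> by the mean value theorem. Since \<open>r\<close> is
  increasing, \<open>r x - r \<xi>\<close> has the sign of \<open>x - x\<^sub>0\<close>, so \<open>h' \<ge> 0\<close> on either side of \<open>x\<^sub>0\<close>. Two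
  points on opposite sides of \<open>x\<^sub>0\<close> are compared by the mean value identity alone, because their
  intermediate points are ordered in the same way.
\<close>
lemma mono_on_quotient_power:
  fixes F F' :: "real \<Rightarrow> real" and a b x0 :: real
  assumes x0: "x0 \<in> {a<..<b}" and cont: "continuous_on {a..b} F" and "F x0 = 0"
    and deriv: "\<And>x. x \<in> {a<..<b} \<Longrightarrow> (F has_real_derivative F' x) (at x)"
    and mono: "mono_on ({a..b} - {x0}) (\<lambda>x. F' x / (x - x0) ^ n)"
  shows "mono_on ({a..b} - {x0}) (\<lambda>x. F x / (x - x0) ^ Suc n)"
proof (rule mono_onI)
  let ?r = "\<lambda>x. F' x / (x - x0) ^ n"
  let ?h = "\<lambda>x. F x / (x - x0) ^ Suc n"
  have mean: "\<exists>\<xi>\<in>open_segment x0 x. real (Suc n) * ?h x = ?r \<xi>" if "x \<in> {a..b} - {x0}" for x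
  proof -
    have sub: "closed_segment x0 x \<subseteq> {a..b}" "open_segment x0 x \<subseteq> {a<..<b}"
      using that x0 by (auto simp: closed_segment_eq_real_ivl open_segment_eq_real_ivl split: if_splits)
    show ?thesis
      using cauchy_mean_value_power[of x0 x F F' n] continuous_on_subset[OF cont sub(1)]
        that \<open>F x0 = 0\<close> deriv sub(2) by blast
  qed
  have h_cont: "continuous_on ({a..b} - {x0}) ?h"
    by (intro continuous_intros continuous_on_subset[OF cont]) auto
  have h_deriv: "\<exists>d. (?h has_real_derivative d) (at x) \<and> 0 \<le> d" if x: "x \<in> {a<..<b} - {x0}" for x
  proof -
    let ?d = "(?r x - real (Suc n) * ?h x) / (x - x0)"
    have "(?h has_real_derivative
        (F' x * (x - x0) ^ Suc n - F x * (real (Suc n) * (x - x0) ^ n)) / ((x - x0) ^ Suc n * (x - x0) ^ Suc n)) (at x)"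
      using x by (auto intro!: derivative_eq_intros deriv simp del: power_Suc)
    moreover have "(F' x * (x - x0) ^ Suc n - F x * (real (Suc n) * (x - x0) ^ n))
        / ((x - x0) ^ Suc n * (x - x0) ^ Suc n) = ?d"
    proof -
      have "(F' x * (u * p) - F x * (N * p)) / (u * p * (u * p)) = (F' x / p - N * (F x / (u * p))) / u"
        if "u \<noteq> 0" "p \<noteq> 0" for u p N :: real
        using that by (simp add: field_simps)
      from this[of "x - x0" "(x - x0) ^ n" "real (Suc n)"] show ?thesis
        using x by (simp only: power_Suc) simp
    qed
    moreover have "0 \<le> ?d"
    proof -
      obtain \<xi> where \<xi>: "\<xi> \<in> open_segment x0 x" "real (Suc n) * ?h x = ?r \<xi>"
        using mean[of x] x by auto
      have \<xi>_in: "\<xi> \<in> {a..b} - {x0}"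
        using \<xi>(1) x x0 by (auto simp: open_segment_eq_real_ivl split: if_splits)
      have "0 \<le> (?r x - ?r \<xi>) / (x - x0)"
      proof (cases "x0 < x")
        case True
        then have "?r \<xi> \<le> ?r x"
          using \<xi>(1) \<xi>_in x by (intro mono_onD[OF mono]) (auto simp: open_segment_eq_real_ivl)
        then show ?thesis using True by simp
      next
        case False
        then have "?r x \<le> ?r \<xi>"
          using \<xi>(1) \<xi>_in x by (intro mono_onD[OF mono]) (auto simp: open_segment_eq_real_ivl)
        then show ?thesis using False by (intro divide_nonpos_nonpos) auto
      qed
      then show ?thesis unfolding \<xi>(2) by simp
    qed
    ultimately show ?thesis by auto
  qed
  fix x y assume xy: "x \<in> {a..b} - {x0}" "y \<in> {a..b} - {x0}" "x \<le> y"
  show "?h x \<le> ?h y"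
  proof (cases "x < x0 \<and> x0 < y")
    case True
    obtain \<xi> where \<xi>: "\<xi> \<in> open_segment x0 x" "real (Suc n) * ?h x = ?r \<xi>"
      using mean xy by blast
    obtain \<eta> where \<eta>: "\<eta> \<in> open_segment x0 y" "real (Suc n) * ?h y = ?r \<eta>"
      using mean xy by blast
    have "?r \<xi> \<le> ?r \<eta>"
      using \<xi>(1) \<eta>(1) xy True by (intro mono_onD[OF mono]) (auto simp: open_segment_eq_real_ivl)
    then have "real (Suc n) * ?h x \<le> real (Suc n) * ?h y" unfolding \<xi>(2) \<eta>(2) .
    then show ?thesis by (rule mult_left_le_imp_le) simp
  next
    case False
    then have sub: "{x..y} \<subseteq> {a..b} - {x0}" using xy by auto
    show ?thesis
    proof (rule DERIV_nonneg_imp_increasing_open[OF \<open>x \<le> y\<close>])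
      show "continuous_on {x..y} ?h" by (rule continuous_on_subset[OF h_cont sub])
      fix z assume z: "x < z" "z < y"
      then have "z \<in> {x..y}" by simp
      with sub have "z \<noteq> x0" by blast
      with z show "\<exists>d. (?h has_real_derivative d) (at z) \<and> 0 \<le> d"
        using xy by (intro h_deriv) auto
    qed
  qed
qed

lemma nth_deriv_on_Suc_shift:
  "nth_deriv_on S (Suc i) f = nth_deriv_on S i (nth_deriv_on S 1 f)"
  by (induction i) simp_all

lemma times_differentiable_on_Suc:
  "times_differentiable_on (Suc k) f S \<longleftrightarrow>
    f differentiable_on S \<and> times_differentiable_on k (nth_deriv_on S 1 f) S"
  unfolding times_differentiable_on_def All_less_Suc2 nth_deriv_on_Suc_shift by simp

lemma taylor_remainder_eq_sum:
  "taylor_remainder S (int k - 1) f x0 x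
    = f x - (\<Sum>i<k. 1 / fact i * nth_deriv_on S i f x0 * (x - x0) ^ i)"
proof -
  have "{i. int i \<le> int k - 1} = {..<k}" by auto
  then show ?thesis by (simp add: taylor_remainder_def taylor_poly_def)
qed

text \<open>
  The constant term of the Taylor polynomial of \<open>f\<close> drops out, and the term of index \<open>i + 1\<close>
  differentiates to the term of index \<open>i\<close> for \<open>f'\<close>. The point \<open>x\<close> is interior, where the
  derivative relative to \<open>[a, b]\<close> is the two-sided one that the mean value theorem needs.
\<close>
lemma taylor_remainder_Suc_derivative:
  assumes "f differentiable_on {a..b}" and "x \<in> {a<..<b}"
  shows "(taylor_remainder {a..b} (int (Suc k) - 1) f x0 has_real_derivative
    taylor_remainder {a..b} (int k - 1) (nth_deriv_on {a..b} 1 f) x0 x) (at x)"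
proof -
  let ?f' = "nth_deriv_on {a..b} 1 f"
  have "f differentiable (at x within {a..b})"
    using assms by (simp add: differentiable_on_def)
  then have "(f has_vector_derivative ?f' x) (at x within {a..b})"
    by (simp add: vector_derivative_works)
  then have f: "(f has_real_derivative ?f' x) (at x)"
    using assms(2) by (simp add: has_real_derivative_iff_has_vector_derivative at_within_Icc_at)
  have eq: "taylor_remainder {a..b} (int (Suc k) - 1) f x0 = (\<lambda>x. f x -
      (f x0 + (\<Sum>i<k. 1 / fact (Suc i) * nth_deriv_on {a..b} i ?f' x0 * (x - x0) ^ Suc i)))"
    unfolding taylor_remainder_eq_sum sum.lessThan_Suc_shift nth_deriv_on_Suc_shift by simp
  have term_deriv: "((\<lambda>x. 1 / fact (Suc i) * c * (x - x0) ^ Suc i) has_real_derivative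
      1 / fact i * c * (x - x0) ^ i) (at x)" for i c
    by (rule derivative_eq_intros refl | simp)+
  show ?thesis
    unfolding eq taylor_remainder_eq_sum[of _ k]
    by (rule derivative_eq_intros f term_deriv refl | simp)+
qed

text \<open>The scalar \<open>c\<close> lets one induction serve both directions: it is used with \<open>c = 1\<close> and
  \<open>c = -1\<close>.\<close>
lemma mono_on_taylor_quotient:
  assumes "x0 \<in> {a<..<b}" and "times_differentiable_on k f {a..b}"
    and "mono_on {a..b} (\<lambda>x. c * nth_deriv_on {a..b} k f x)"
  shows "mono_on ({a..b} - {x0})
    (\<lambda>x. c * (taylor_remainder {a..b} (int k - 1) f x0 x / (x - x0) ^ k))"
  using assms(2,3)
proof (induction k arbitrary: f)
  case 0
  then show ?case
    by (auto simp: taylor_remainder_def taylor_poly_neg1 intro: mono_on_subset)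
next
  case (Suc k)
  let ?S = "{a..b}"
  let ?f' = "nth_deriv_on ?S 1 f"
  let ?R = "taylor_remainder ?S (int (Suc k) - 1) f x0"
  let ?R' = "taylor_remainder ?S (int k - 1) ?f' x0"
  have f: "f differentiable_on ?S" and f': "times_differentiable_on k ?f' ?S"
    using Suc.prems(1) by (auto simp: times_differentiable_on_Suc)
  have "mono_on ?S (\<lambda>x. c * nth_deriv_on ?S k ?f' x)"
    using Suc.prems(2) by (simp only: nth_deriv_on_Suc_shift)
  then have IH: "mono_on (?S - {x0}) (\<lambda>x. c * ?R' x / (x - x0) ^ k)"
    using Suc.IH[OF f'] by simp
  have "mono_on (?S - {x0}) (\<lambda>x. c * ?R x / (x - x0) ^ Suc k)"
  proof (rule mono_on_quotient_power[OF assms(1) _ _ _ IH])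
    show "continuous_on ?S (\<lambda>x. c * ?R x)"
      unfolding taylor_remainder_eq_sum
      by (intro continuous_intros differentiable_imp_continuous_on f)
    show "c * ?R x0 = 0"
      unfolding taylor_remainder_eq_sum sum.lessThan_Suc_shift by simp
    show "((\<lambda>x. c * ?R x) has_real_derivative c * ?R' x) (at x)" if "x \<in> {a<..<b}" for x
      by (intro DERIV_cmult taylor_remainder_Suc_derivative f that)
  qed
  then show ?case by simp
qed

lemma sharp_taylor_interval_eq_Icc:
  assumes q: "\<And>x. q x = taylor_remainder S (int k - 1) f x0 x / (x - x0) ^ k"
    and "u \<in> S - {x0}" and "v \<in> S - {x0}"
    and bounds: "\<And>x. x \<in> S - {x0} \<Longrightarrow> q u \<le> q x \<and> q x \<le> q v"
  shows "sharp_taylor_interval k f x0 S = {q u..q v}"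
proof -
  have "(INF x\<in>S - {x0}. ereal (q x)) = ereal (q u)"
    using assms(2) bounds by (intro INF_eqI) auto
  moreover have "(SUP x\<in>S - {x0}. ereal (q x)) = ereal (q v)"
    using assms(3) bounds by (intro SUP_eqI) auto
  ultimately show ?thesis
    by (auto simp: sharp_taylor_interval_def q[symmetric])
qed

theorem theorem1:
  fixes f :: "real \<Rightarrow> real" and k :: nat and a b x0 :: real
  assumes "times_differentiable_on k f {a..b}"
    and "x0 \<in> {a<..<b}"
  shows "(mono_on {a..b} (nth_deriv_on {a..b} k f) \<longrightarrow>
            sharp_taylor_interval k f x0 {a..b} =
              {taylor_remainder {a..b} (int k - 1) f x0 a / (a - x0) ^ k ..
               taylor_remainder {a..b} (int k - 1) f x0 b / (b - x0) ^ k})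
       \<and> (antimono_on {a..b} (nth_deriv_on {a..b} k f) \<longrightarrow>
            sharp_taylor_interval k f x0 {a..b} =
              {taylor_remainder {a..b} (int k - 1) f x0 b / (b - x0) ^ k ..
               taylor_remainder {a..b} (int k - 1) f x0 a / (a - x0) ^ k})"
proof -
  let ?D = "nth_deriv_on {a..b} k f"
  let ?q = "\<lambda>x. taylor_remainder {a..b} (int k - 1) f x0 x / (x - x0) ^ k"
  have ends: "a \<in> {a..b} - {x0}" "b \<in> {a..b} - {x0}" using assms(2) by auto
  have bounds: "c * ?q a \<le> c * ?q x \<and> c * ?q x \<le> c * ?q b"
    if "mono_on {a..b} (\<lambda>x. c * ?D x)" "x \<in> {a..b} - {x0}" for c x
    using mono_onD[OF mono_on_taylor_quotient[OF assms(2,1) that(1)]] ends that(2) by simp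
  show ?thesis
  proof (intro conjI impI)
    assume "mono_on {a..b} ?D"
    then show "sharp_taylor_interval k f x0 {a..b} = {?q a..?q b}"
      using bounds[of 1] by (intro sharp_taylor_interval_eq_Icc[where q = ?q] ends) simp_all
  next
    assume "antimono_on {a..b} ?D"
    then have "mono_on {a..b} (\<lambda>x. - 1 * ?D x)"
      by (auto simp: monotone_on_def)
    then show "sharp_taylor_interval k f x0 {a..b} = {?q b..?q a}"
      using bounds[of "- 1"] by (intro sharp_taylor_interval_eq_Icc[where q = ?q] ends) simp_all
  qed
qed

end
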